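(* Let $n\ge 1$ be an integer, let $G$ be the $(2n+1)$-dimensional solvable matrix Lie group equipped with the left-invariant Riemannian metric $g$ described in the context (for some constant $\lambda\neq 0$), and let $\tau_G=(T_G,\pi_G,G,\mathbb{R}^{2n+1})$ be its tangent bundle, with base space $(G,g)$. Then: (i) There are $2n+1$ linearly independent homogeneous geodesics through the origin $e$ of the base space of $\tau_G$. (ii) If $n+1$ is odd, the maximum number of mutually orthogonal homogeneous geodesics through the origin $e$ of the base space of $\tau_G$ is $n+1$. (iii) If $n+1$ is even and not divisible by $4$, the maximum number of mutually orthogonal homogeneous geodesics through the origin $e$ of the base space of $\tau_G$ is $n+2$. (iv) If $n+1$ is even and divisible by $4$ and there exists a Hadamard matrix of order $n+1$, the maximum number of mutually orthogonal homogeneous geodesics through the origin $e$ of the base space of $\tau_G$ is $2n+1$.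
   Context: The group $G$: all $(n+2)\times(n+2)$ real matrices of the form $$\begin{pmatrix} e^{z_0} & 0 & \cdots & 0 & x_0\\ 0 & e^{z_1} & \cdots & 0 & x_1\\ \vdots & \vdots & \ddots & \vdots & \vdots\\ 0 & 0 & \cdots & e^{z_n} & x_n\\ 0 & 0 & \cdots & 0 & 1\end{pmatrix},$$ where $(x_0,x_1,\dots,x_n,z_1,\dots,z_n)\in\mathbb{R}^{2n+1}$ and $z_0=-(z_1+\cdots+z_n)$. These parameters are global coordinates on $G$; the origin (identity) $e$ is the point $(0,\dots,0)$. $G$ carries the left-invariant Riemannian metric $$g=\sum_{i=0}^n e^{-2z_i}\,dx_i^2+\lambda^2\sum_{0\le k\le j\le n}dz_k\,dz_j,\qquad dz_0=-(dz_1+\cdots+dz_n),$$ with $\lambda\ne 0$ a constant. $G$ acts on itself by left translations, so $(G,g)$ is a homogeneous Riemannian manifold with trivial isotropy group $K=\{e\}$ in $G$. Let $\mathcal{G}=T_eG$ be the Lie algebra of $G$. A homogeneous geodesic through $e$ is a geodesic $\gamma$ of $(G,g)$ of the form $\gamma(t)=\exp(tX)\cdot e=\exp(tX)$ for some nonzero $X\in\mathcal{G}$; $X$ is then called the corresponding homogeneous (geodesic) vector. A finite family of homogeneous geodesics through $e$ is called orthogonal (respectively, linearly independent) if the corresponding homogeneous vectors in $\mathcal{G}=T_eG$ are mutually orthogonal with respect to $g_e$ (respectively, linearly independent). A Hadamard matrix of order $k$ is a $k\times k$ matrix $A$ with all entries equal to $\pm1$ such that $AA^t=kI_k$, where $I_k$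 is the identity matrix. *)

theory Defs
  imports "HOL-Analysis.Analysis" "HOL-Library.Option_ord"
begin

text \<open>
  The integer \<open>n \<ge> 1\<close> is \<open>CARD('n)\<close>, where the finite linearly ordered type \<open>'n\<close> stands for
  the index set \<open>{1, ..., n}\<close>. Then \<open>'n option\<close> stands for \<open>{0, ..., n}\<close>, with \<open>None\<close> as the
  index \<open>0\<close> (the least element in the order of \<open>Option_ord\<close>), and \<open>'n option option\<close> indexes the
  rows and columns of the matrices, with the outer \<open>None\<close> as the last index \<open>n + 1\<close>.
  A point of \<open>'n coords\<close> is \<open>((x_0, ..., x_n), (z_1, ..., z_n))\<close>.
\<close>

type_synonym 'n coords = "(real^('n option)) \<times> (real^'n)"
type_synonym 'n gmatrix = "real^('n option option)^('n option option)"

definition full_z :: "real^'n \<Rightarrow> 'n option \<Rightarrow> real" where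
  "full_z z i = (case i of None \<Rightarrow> - (\<Sum>j\<in>UNIV. z $ j) | Some j \<Rightarrow> z $ j)"

definition G_param :: "'n::finite coords \<Rightarrow> 'n gmatrix" where
  "G_param p = (\<chi> i j.
     (case (i, j) of
        (Some k, Some l) \<Rightarrow> (if k = l then exp (full_z (snd p) k) else 0)
      | (Some k, None) \<Rightarrow> fst p $ k
      | (None, Some l) \<Rightarrow> 0
      | (None, None) \<Rightarrow> 1))"

definition G_group :: "'n::finite gmatrix set" where
  "G_group = range G_param"

definition G_coords :: "'n::finite gmatrix \<Rightarrow> 'n coords" where
  "G_coords = inv G_param"

definition G_diff :: "'n::finite gmatrix \<Rightarrow> 'n coords \<Rightarrow> 'n gmatrix" where
  "G_diff A = frechet_derivative G_param (at (G_coords A))"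

definition tangent_space :: "'n::finite gmatrix \<Rightarrow> 'n gmatrix set" where
  "tangent_space A = range (G_diff A)"

text \<open>
  The metric in the global coordinates, polarised: \<open>dz_k dz_j\<close> is the symmetric product
  \<open>(dz_k \<otimes> dz_j + dz_j \<otimes> dz_k) / 2\<close>. The function \<open>full_z\<close>, being linear, also
  computes \<open>dz_0 = - (dz_1 + ... + dz_n)\<close> on tangent vectors.
\<close>

definition coord_metric ::
  "real \<Rightarrow> 'n::{finite,linorder} coords \<Rightarrow> 'n coords \<Rightarrow> 'n coords \<Rightarrow> real" where
  "coord_metric lam p u v =
     (\<Sum>i\<in>UNIV. exp (- 2 * full_z (snd p) i) * (fst u $ i) * (fst v $ i)) +
     lam\<^sup>2 * (\<Sum>(k, j)\<in>{(k, j). k \<le> j}.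
            (full_z (snd u) k * full_z (snd v) j + full_z (snd u) j * full_z (snd v) k) / 2)"

definition G_metric ::
  "real \<Rightarrow> 'n::{finite,linorder} gmatrix \<Rightarrow> 'n gmatrix \<Rightarrow> 'n gmatrix \<Rightarrow> real" where
  "G_metric lam A X Y =
     coord_metric lam (G_coords A) (inv (G_diff A) X) (inv (G_diff A) Y)"

text \<open>
  The Christoffel map \<open>\<Gamma>_p(u, v)\<close> of the Levi-Civita connection in a global chart:
  \<open>\<Sum>_k g_(kl) \<Gamma>^k_(ij) = (\<partial>_i g_(jl) + \<partial>_j g_(il) - \<partial>_l g_(ij)) / 2\<close>, contracted
  with \<open>u\<^sup>i v\<^sup>j y\<^sup>l\<close>. In the chart, the covariant derivative of \<open>c'\<close> along \<open>c\<close> is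
  \<open>c'' + \<Gamma>_c(c', c')\<close>.
\<close>

definition christoffel ::
  "('a::real_normed_vector \<Rightarrow> 'a \<Rightarrow> 'a \<Rightarrow> real) \<Rightarrow> 'a \<Rightarrow> 'a \<Rightarrow> 'a \<Rightarrow> 'a" where
  "christoffel g p u v = (THE w. \<forall>y. g p w y =
     (frechet_derivative (\<lambda>q. g q v y) (at p) u
      + frechet_derivative (\<lambda>q. g q u y) (at p) v
      - frechet_derivative (\<lambda>q. g q u v) (at p) y) / 2)"

definition chart_geodesic ::
  "('a::real_normed_vector \<Rightarrow> 'a \<Rightarrow> 'a \<Rightarrow> real) \<Rightarrow> (real \<Rightarrow> 'a) \<Rightarrow> bool" where
  "chart_geodesic g c \<longleftrightarrow> (\<exists>c' c''. \<forall>t.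
     (c has_vector_derivative c' t) (at t) \<and>
     (c' has_vector_derivative c'' t) (at t) \<and>
     c'' t + christoffel g (c t) (c' t) (c' t) = 0)"

definition G_geodesic :: "real \<Rightarrow> (real \<Rightarrow> 'n::{finite,linorder} gmatrix) \<Rightarrow> bool" where
  "G_geodesic lam \<gamma> \<longleftrightarrow> range \<gamma> \<subseteq> G_group \<and> chart_geodesic (coord_metric lam) (G_coords \<circ> \<gamma>)"

text \<open>The matrix ring has no \<open>exp\<close> in the library (\<open>*\<close> on vectors is componentwise).\<close>

definition matrix_exp :: "real^'m^'m \<Rightarrow> real^'m^'m" where
  "matrix_exp A = (\<Sum>k. (1 / fact k) *\<^sub>R (((**) A ^^ k) (mat 1)))"

definition homogeneous_geodesic ::
  "real \<Rightarrow> 'n::{finite,linorder} gmatrix \<Rightarrow> (real \<Rightarrow> 'n gmatrix) \<Rightarrow> bool" where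
  "homogeneous_geodesic lam X \<gamma> \<longleftrightarrow>
     X \<in> tangent_space (mat 1) \<and> X \<noteq> 0 \<and>
     \<gamma> = (\<lambda>t. matrix_exp (t *\<^sub>R X)) \<and> G_geodesic lam \<gamma>"

text \<open>
  Families are finite sets of curves; \<open>X \<gamma>\<close> is the homogeneous vector corresponding to \<open>\<gamma>\<close>.
  Distinct curves have distinct vectors, as \<open>X \<gamma>\<close> determines \<open>\<gamma>\<close>.
\<close>

definition orthogonal_homogeneous_geodesics ::
  "real \<Rightarrow> (real \<Rightarrow> 'n::{finite,linorder} gmatrix) set \<Rightarrow> bool" where
  "orthogonal_homogeneous_geodesics lam \<Gamma> \<longleftrightarrow> finite \<Gamma> \<and>
     (\<exists>X. (\<forall>\<gamma>\<in>\<Gamma>. homogeneous_geodesic lam (X \<gamma>) \<gamma>) \<and>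
          pairwise (\<lambda>\<gamma> \<delta>. G_metric lam (mat 1) (X \<gamma>) (X \<delta>) = 0) \<Gamma>)"

definition independent_homogeneous_geodesics ::
  "real \<Rightarrow> (real \<Rightarrow> 'n::{finite,linorder} gmatrix) set \<Rightarrow> bool" where
  "independent_homogeneous_geodesics lam \<Gamma> \<longleftrightarrow> finite \<Gamma> \<and>
     (\<exists>X. (\<forall>\<gamma>\<in>\<Gamma>. homogeneous_geodesic lam (X \<gamma>) \<gamma>) \<and> independent (X ` \<Gamma>))"

definition max_card :: "('a set \<Rightarrow> bool) \<Rightarrow> nat \<Rightarrow> bool" where
  "max_card P m \<longleftrightarrow> (\<exists>S. P S \<and> card S = m) \<and> (\<forall>S. P S \<longrightarrow> card S \<le> m)"

definition hadamard_matrix :: "real^'k^'k \<Rightarrow> bool" where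
  "hadamard_matrix A \<longleftrightarrow>
     (\<forall>i j. A $ i $ j = 1 \<or> A $ i $ j = - 1) \<and>
     A ** transpose A = real CARD('k) *\<^sub>R mat 1"

end

theory Submission
  imports Defs
begin

text \<open>
  Since \<open>dz_0 + \<dots> + dz_n = 0\<close>, the quadratic form \<open>\<Sum>_{k \<le> j} dz_k dz_j\<close> equals
  \<open>(dz_0\<^sup>2 + \<dots> + dz_n\<^sup>2) / 2\<close>, so the metric is diagonal in the redundant coordinates
  \<open>(x_0, \<dots>, x_n, z_0, \<dots>, z_n)\<close> (\<open>coord_metric_eq\<close>). Write a vector of the Lie algebra as
  \<open>(a, b)\<close>, with \<open>b\<close> extended to \<open>n + 1\<close> entries of sum zero. Its one-parameter subgroup has
  \<open>x_i' = a_i exp (t b_i)\<close> and \<open>z_i = t b_i\<close>, and the geodesic equation for this curve says: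
  \<open>a_i b_i = 0\<close> for all \<open>i\<close>, and \<open>a_i\<^sup>2\<close> does not depend on \<open>i\<close>. So there are exactly two kinds of
  homogeneous vectors (\<open>homogeneous_geodesic_iff\<close>): the vectors \<open>(0, b)\<close>, and the vectors
  \<open>(a, 0)\<close> whose entries \<open>a_i\<close> all have the same modulus.

  These vectors span the Lie algebra, because differences of sign vectors give the coordinate
  axes; a basis chosen among them yields \<open>2 n + 1\<close> independent homogeneous geodesics.

  The two kinds are orthogonal to each other. Vectors of the first kind fill an
  \<open>n\<close>-dimensional Euclidean space and so always contribute \<open>n\<close> to a maximal orthogonal family.
  The problem is thereby reduced to orthogonal families of multiples of sign vectors in
  \<open>\<real>^(n + 1)\<close> (\<open>max_card_orthogonal_homogeneous_geodesics\<close>). Two orthogonal sign vectors force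
  the dimension to be even, three force it to be divisible by 4, and the rows of a Hadamard
  matrix form an orthogonal family of the largest size that the dimension admits. The maxima
  are therefore \<open>1\<close>, \<open>2\<close> and \<open>n + 1\<close> in the three cases.
\<close>

section \<open>The metric\<close>

lemma sum_UNIV_option:
  fixes f :: "'a::finite option \<Rightarrow> 'b::comm_monoid_add"
  shows "(\<Sum>i\<in>UNIV. f i) = f None + (\<Sum>j\<in>UNIV. f (Some j))"
  by (simp add: UNIV_option_conv sum.reindex o_def)

lemma full_z_simps [simp]:
  "full_z z None = - (\<Sum>j\<in>UNIV. z $ j)"
  "full_z z (Some j) = z $ j"
  by (simp_all add: full_z_def)

lemma full_z_linear [simp]:
  "full_z 0 i = 0"
  "full_z (- z) i = - full_z z i"
  "full_z (z + z') i = full_z z i + full_z z' i"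
  "full_z (z - z') i = full_z z i - full_z z' i"
  "full_z (r *\<^sub>R z) i = r * full_z z i"
  by (cases i; simp add: sum_negf sum.distrib sum_subtractf sum_distrib_left)+

lemma sum_full_z [simp]: "(\<Sum>i\<in>UNIV. full_z z i) = 0"
  by (simp add: sum_UNIV_option)

text \<open>
  The sum-zero hyperplane of \<open>\<real>^(n + 1)\<close> is parametrised by \<open>full_z\<close>: dropping the entry with
  index 0 is the inverse.
\<close>

lemma full_z_restrict:
  fixes x :: "real^('n::finite option)"
  assumes "(\<Sum>i\<in>UNIV. x $ i) = 0"
  shows "full_z (\<chi> j. x $ Some j) i = x $ i"
  using assms by (cases i) (simp_all add: sum_UNIV_option)

lemma full_z_eq_0D: "(\<And>i. full_z z i = 0) \<Longrightarrow> z = 0"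
  by (metis full_z_simps(2) vec_eq_iff zero_index)

lemma sum_le_pairs:
  fixes f :: "'a::{finite,linorder} \<Rightarrow> 'a \<Rightarrow> real"
  shows "(\<Sum>(k, j)\<in>{(k, j). k \<le> j}. (f k j + f j k) / 2)
       = ((\<Sum>k\<in>UNIV. \<Sum>j\<in>UNIV. f k j) + (\<Sum>k\<in>UNIV. f k k)) / 2"
proof -
  let ?le = "{(k::'a, j). k \<le> j}" and ?ge = "{(k::'a, j). j \<le> k}"
  have swap: "(\<Sum>(k, j)\<in>?le. f j k) = (\<Sum>(k, j)\<in>?ge. f k j)"
    by (rule sum.reindex_bij_witness[of _ prod.swap prod.swap]) auto
  have diag: "(\<Sum>(k, j)\<in>?le \<inter> ?ge. f k j) = (\<Sum>k\<in>UNIV. f k k)"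
    by (rule sum.reindex_bij_witness[of _ "\<lambda>k. (k, k)" fst]) auto
  have all: "?le \<union> ?ge = UNIV \<times> UNIV" by auto
  have "(\<Sum>(k, j)\<in>?le. (f k j + f j k) / 2)
      = ((\<Sum>(k, j)\<in>?le. f k j) + (\<Sum>(k, j)\<in>?ge. f k j)) / 2"
    unfolding swap[symmetric] sum.distrib[symmetric] sum_divide_distrib
    by (simp add: case_prod_unfold)
  also have "(\<Sum>(k, j)\<in>?le. f k j) + (\<Sum>(k, j)\<in>?ge. f k j)
      = (\<Sum>(k, j)\<in>?le \<union> ?ge. f k j) + (\<Sum>(k, j)\<in>?le \<inter> ?ge. f k j)"
    by (rule sum.union_inter[symmetric]) simp_all
  finally show ?thesis
    by (simp only: all diag sum.cartesian_product)
qed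

text \<open>
  The mixed terms of the \<open>z\<close>-part add up to a product of two full sums, each of which vanishes;
  only the diagonal survives, with weight one half.
\<close>

lemma coord_metric_eq:
  fixes u v :: "'n::{finite,linorder} coords"
  shows "coord_metric lam p u v =
    (\<Sum>i\<in>UNIV. exp (- 2 * full_z (snd p) i) * (fst u $ i) * (fst v $ i))
    + lam\<^sup>2 / 2 * (\<Sum>i\<in>UNIV. full_z (snd u) i * full_z (snd v) i)"
proof -
  have "(\<Sum>k\<in>UNIV. \<Sum>j\<in>UNIV. full_z (snd u) k * full_z (snd v) j) = 0"
    by (simp add: sum_distrib_left[symmetric])
  then show ?thesis
    by (simp add: coord_metric_def sum_le_pairs[of "\<lambda>k j. full_z (snd u) k * full_z (snd v) j"]
        mult.commute)
qed

lemma coord_metric_linear: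
  "coord_metric lam p (- u) v = - coord_metric lam p u v"
  "coord_metric lam p (u - w) v = coord_metric lam p u v - coord_metric lam p w v"
  by (simp_all add: coord_metric_eq sum_negf sum_subtractf algebra_simps)

lemma coord_metric_nondegenerate:
  assumes "lam \<noteq> 0" and "coord_metric lam p u u = 0"
  shows "u = 0"
proof -
  let ?A = "\<Sum>i\<in>UNIV. exp (- 2 * full_z (snd p) i) * (fst u $ i) * (fst u $ i)"
  let ?B = "\<Sum>i\<in>UNIV. full_z (snd u) i * full_z (snd u) i"
  have "?A \<ge> 0" "?B \<ge> 0"
    by (auto intro!: sum_nonneg simp: mult.assoc)
  then have "?A \<ge> 0" "lam\<^sup>2 / 2 * ?B \<ge> 0"
    by simp_all
  moreover have "?A + lam\<^sup>2 / 2 * ?B = 0"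
    using assms(2) by (simp only: coord_metric_eq)
  ultimately have "?A = 0" "?B = 0"
    using assms(1) by (auto simp: add_nonneg_eq_0_iff)
  then have "\<forall>i\<in>UNIV. exp (- 2 * full_z (snd p) i) * (fst u $ i) * (fst u $ i) = 0"
    and "\<forall>i\<in>UNIV. full_z (snd u) i * full_z (snd u) i = 0"
    by (subst (asm) sum_nonneg_eq_0_iff; simp add: mult.assoc)+
  then have "fst u = 0"
    by (simp add: vec_eq_iff)
  moreover have "snd u = 0"
    by (rule full_z_eq_0D) (use \<open>\<forall>i\<in>UNIV. full_z (snd u) i * full_z (snd u) i = 0\<close> in simp)
  ultimately show ?thesis by (simp add: prod_eq_iff)
qed

section \<open>The geodesic equation\<close>

lemma full_z_has_derivative:
  "((\<lambda>q::'n::finite coords. full_z (snd q) i) has_derivative (\<lambda>y. full_z (snd y) i)) (at p)"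
proof -
  have "bounded_linear (\<lambda>q::'n coords. full_z (snd q) i)"
    by (simp add: linear_conv_bounded_linear[symmetric] linear_iff)
  then show ?thesis
    by (rule bounded_linear.has_derivative) simp
qed

lemma coord_metric_has_derivative:
  "((\<lambda>q. coord_metric lam q u v) has_derivative
    (\<lambda>y. \<Sum>i\<in>UNIV. - 2 * full_z (snd y) i * exp (- 2 * full_z (snd p) i)
           * (fst u $ i) * (fst v $ i))) (at p)"
proof -
  show ?thesis
    unfolding coord_metric_eq
    by (auto intro!: derivative_eq_intros full_z_has_derivative sum.cong simp: algebra_simps)
qed

text \<open>
  The definite description in the Christoffel map denotes something only if the defining equation
  has a unique solution. Uniqueness is nondegeneracy; a solution is written down explicitly. Only
  the diagonal values \<open>\<Gamma>(u, u)\<close> enter the geodesic equation.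
\<close>

lemma christoffel_coord_metric_iff:
  assumes "lam \<noteq> 0"
  shows "christoffel (coord_metric lam) p u u = w \<longleftrightarrow>
    (\<forall>y. coord_metric lam p w y =
       (\<Sum>i\<in>UNIV. full_z (snd y) i * exp (- 2 * full_z (snd p) i) * (fst u $ i)\<^sup>2)
       - 2 * (\<Sum>i\<in>UNIV. full_z (snd u) i * exp (- 2 * full_z (snd p) i) * (fst u $ i) * (fst y $ i)))"
    (is "_ \<longleftrightarrow> (\<forall>y. _ = ?R y)")
proof -
  have fd: "frechet_derivative (\<lambda>q. coord_metric lam q v v') (at p) =
      (\<lambda>y. \<Sum>i\<in>UNIV. - 2 * full_z (snd y) i * exp (- 2 * full_z (snd p) i)
           * (fst v $ i) * (fst v' $ i))" for v v'
    by (rule frechet_derivative_at[symmetric, OF coord_metric_has_derivative])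
  have "(frechet_derivative (\<lambda>q. coord_metric lam q u y) (at p) u
      + frechet_derivative (\<lambda>q. coord_metric lam q u y) (at p) u
      - frechet_derivative (\<lambda>q. coord_metric lam q u u) (at p) y) / 2 = ?R y" for y
  proof -
    have "(\<Sum>i\<in>UNIV. - 2 * full_z (snd u) i * exp (- 2 * full_z (snd p) i) * (fst u $ i) * (fst y $ i))
        = - 2 * (\<Sum>i\<in>UNIV. full_z (snd u) i * exp (- 2 * full_z (snd p) i) * (fst u $ i) * (fst y $ i))"
      and "(\<Sum>i\<in>UNIV. - 2 * full_z (snd y) i * exp (- 2 * full_z (snd p) i) * (fst u $ i) * (fst u $ i))
        = - 2 * (\<Sum>i\<in>UNIV. full_z (snd y) i * exp (- 2 * full_z (snd p) i) * (fst u $ i)\<^sup>2)"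
      by (simp_all only: sum_distrib_left power2_eq_square mult.assoc)
    then show ?thesis
      unfolding fd by (simp only:) simp
  qed
  then have chr: "christoffel (coord_metric lam) p u u = (THE w. \<forall>y. coord_metric lam p w y = ?R y)"
    by (simp only: christoffel_def)
  define m :: "'a option \<Rightarrow> real"
    where "m i = exp (- 2 * full_z (snd p) i) * (fst u $ i)\<^sup>2" for i
  \<comment> \<open>A \<open>z\<close>-component has sum zero, so only \<open>m\<close> minus its mean can be represented; the mean
      pairs to zero with every \<open>full_z\<close>, hence it is not missed on the right-hand side.\<close>
  define M where "M = (\<Sum>i\<in>UNIV. m i) / CARD('a option)"
  define x where "x = (\<chi> i. 2 / lam\<^sup>2 * (m i - M))"
  define w0 :: "'a coords"
    where "w0 = ((\<chi> i. - 2 * full_z (snd u) i * (fst u $ i)), (\<chi> j. x $ Some j))"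
  have "(\<Sum>i\<in>UNIV. x $ i) = 2 / lam\<^sup>2 * (\<Sum>i\<in>UNIV. m i - M)"
    by (simp only: x_def vec_lambda_beta sum_distrib_left)
  also have "\<dots> = 0"
    by (simp add: M_def sum_subtractf del: card_option)
  finally have "(\<Sum>i\<in>UNIV. x $ i) = 0" .
  then have full: "full_z (snd w0) i = 2 / lam\<^sup>2 * (m i - M)" for i
    by (simp add: w0_def full_z_restrict) (simp add: x_def)
  have ex: "coord_metric lam p w0 y = ?R y" for y
  proof -
    have "lam\<^sup>2 / 2 * (\<Sum>i\<in>UNIV. full_z (snd w0) i * full_z (snd y) i)
        = (\<Sum>i\<in>UNIV. (m i - M) * full_z (snd y) i)"
      unfolding sum_distrib_left full using assms by (intro sum.cong) simp_all
    also have "\<dots> = (\<Sum>i\<in>UNIV. m i * full_z (snd y) i)"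
      by (simp add: left_diff_distrib sum_subtractf flip: sum_distrib_left)
    finally show ?thesis
      unfolding coord_metric_eq
      by (simp add: w0_def m_def sum_distrib_left sum_negf algebra_simps)
  qed
  have uniq: "w = w'"
    if "\<forall>y. coord_metric lam p w y = ?R y" "\<forall>y. coord_metric lam p w' y = ?R y" for w w'
    using coord_metric_nondegenerate[OF assms, of p "w - w'"] that
    by (simp add: coord_metric_linear)
  have "(THE w. \<forall>y. coord_metric lam p w y = ?R y) = w0"
    using ex uniq by (intro the_equality) blast+
  then show ?thesis
    using ex uniq chr by metis
qed

section \<open>One-parameter subgroups\<close>

text \<open>
  The Lie algebra element with coordinates \<open>u\<close>; it is also the derivative of \<open>G_param\<close> at the
  identity, by \<open>G_diff_mat_1\<close>.
\<close>

definition alg_mat :: "'n::finite coords \<Rightarrow> 'n gmatrix" where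
  "alg_mat u = (\<chi> i j.
     (case (i, j) of
        (Some k, Some l) \<Rightarrow> (if k = l then full_z (snd u) k else 0)
      | (Some k, None) \<Rightarrow> fst u $ k
      | (None, _) \<Rightarrow> 0))"

lemma linear_alg_mat: "linear alg_mat"
  by (auto simp: linear_iff alg_mat_def vec_eq_iff split: option.splits)

lemma inj_alg_mat: "inj alg_mat"
proof (rule injI)
  fix u v :: "'a coords"
  assume eq: "alg_mat u = alg_mat v"
  have "fst u $ k = fst v $ k" for k
    using arg_cong[OF eq, of "\<lambda>A. A $ Some k $ None"] by (simp add: alg_mat_def)
  moreover have "snd u $ k = snd v $ k" for k
    using arg_cong[OF eq, of "\<lambda>A. A $ Some (Some k) $ Some (Some k)"] by (simp add: alg_mat_def)
  ultimately show "u = v" by (simp add: prod_eq_iff vec_eq_iff)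
qed

lemma inj_G_param: "inj G_param"
proof (rule injI)
  fix u v :: "'a coords"
  assume eq: "G_param u = G_param v"
  have "fst u $ k = fst v $ k" for k
    using arg_cong[OF eq, of "\<lambda>A. A $ Some k $ None"] by (simp add: G_param_def)
  moreover have "snd u $ k = snd v $ k" for k
    using arg_cong[OF eq, of "\<lambda>A. A $ Some (Some k) $ Some (Some k)"] by (simp add: G_param_def)
  ultimately show "u = v" by (simp add: prod_eq_iff vec_eq_iff)
qed

lemma G_coords_G_param [simp]: "G_coords (G_param p) = p"
  by (simp add: G_coords_def inj_G_param)

lemma G_param_0: "G_param 0 = mat 1"
  by (auto simp: G_param_def mat_def vec_eq_iff split: option.splits)

lemma has_derivative_vecI:
  fixes f :: "'a::real_normed_vector \<Rightarrow> 'b::euclidean_space^'k"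
  assumes "\<And>i. ((\<lambda>x. f x $ i) has_derivative (\<lambda>h. f' h $ i)) (at p)"
  shows "(f has_derivative f') (at p)"
  unfolding has_derivative_componentwise_within[of f f']
proof
  fix b :: "'b^'k" assume "b \<in> Basis"
  then obtain i c where b: "b = axis i c" by (auto simp: Basis_vec_def)
  show "((\<lambda>x. f x \<bullet> b) has_derivative (\<lambda>x. f' x \<bullet> b)) (at p)"
    unfolding b inner_axis by (intro derivative_intros assms)
qed

lemma G_param_has_derivative_0: "(G_param has_derivative alg_mat) (at 0)"
proof (intro has_derivative_vecI)
  fix i j :: "'a option option"
  have lin: "bounded_linear (\<lambda>q::'a coords. fst q $ k)" for k
    by (simp add: linear_conv_bounded_linear[symmetric] linear_iff)
  have *: "((\<lambda>q::'a coords. fst q $ k) has_derivative (\<lambda>y. fst y $ k)) (at 0)" for k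
    using lin by (rule bounded_linear.has_derivative) simp
  show "((\<lambda>x. G_param x $ i $ j) has_derivative (\<lambda>h. alg_mat h $ i $ j)) (at 0)"
  proof (cases "i = j \<and> i \<noteq> None")
    case True
    then show ?thesis
      by (cases i) (auto simp: G_param_def alg_mat_def intro!: derivative_eq_intros full_z_has_derivative)
  next
    case False
    then show ?thesis
      by (cases i; cases j) (auto simp: G_param_def alg_mat_def intro!: derivative_eq_intros *)
  qed
qed

lemma G_diff_mat_1: "G_diff (mat 1 :: 'n::finite gmatrix) = alg_mat"
  unfolding G_diff_def G_param_0[symmetric] G_coords_G_param
  by (rule frechet_derivative_at[symmetric, OF G_param_has_derivative_0])

lemma G_metric_mat_1:
  "G_metric lam (mat 1) (alg_mat u) (alg_mat v) = coord_metric lam 0 u v"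
  using G_coords_G_param[of "0 :: 'a coords"]
  by (simp add: G_metric_def G_diff_mat_1 G_param_0 inj_alg_mat)

text \<open>
  The integral of \<open>exp (s w)\<close> over \<open>s\<close> from \<open>0\<close> to \<open>1\<close>, which appears in the last column of the
  matrix exponential.
\<close>

definition exp_ratio :: "real \<Rightarrow> real" where
  "exp_ratio w = (if w = 0 then 1 else (exp w - 1) / w)"

definition exp_coords :: "'n::finite coords \<Rightarrow> 'n coords" where
  "exp_coords u = ((\<chi> i. fst u $ i * exp_ratio (full_z (snd u) i)), snd u)"

lemma exp_ratio_nonzero: "exp_ratio w \<noteq> 0"
  by (simp add: exp_ratio_def)

lemma exp_sums: "(\<lambda>k. w ^ k / fact k) sums exp (w::real)"
  using exp_converges[of w] by (simp add: field_simps)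

lemma exp_ratio_sums:
  "(\<lambda>k. if k = 0 then 0 else w ^ (k - 1) / fact k) sums exp_ratio w"
proof (cases "w = 0")
  case True
  have "(\<lambda>k. if k = 0 then 0 else w ^ (k - 1) / fact k)
      = (\<lambda>k. if k = Suc 0 then 1 else 0)"
    by (auto simp: True fun_eq_iff power_0_left)
  then show ?thesis using sums_single[of "Suc 0" "\<lambda>_. 1::real"] by (simp add: exp_ratio_def True)
next
  case False
  have "(\<lambda>k. (w ^ k / fact k - (if k = 0 then 1 else 0)) / w) sums ((exp w - 1) / w)"
    using sums_single[of 0 "\<lambda>_. 1::real"] by (intro sums_divide sums_diff exp_sums) simp
  moreover have "(\<lambda>k. (w ^ k / fact k - (if k = 0 then 1 else 0)) / w)
      = (\<lambda>k. if k = 0 then 0 else w ^ (k - 1) / fact k)"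
    using False by (auto simp: fun_eq_iff gr0_conv_Suc)
  ultimately show ?thesis by (simp add: exp_ratio_def False)
qed

lemma alg_mat_power:
  "((**) (alg_mat u) ^^ m) (mat 1) = (\<chi> i j.
     (case (i, j) of
        (Some k, Some l) \<Rightarrow> (if k = l then full_z (snd u) k ^ m else 0)
      | (Some k, None) \<Rightarrow> (if m = 0 then 0 else fst u $ k * full_z (snd u) k ^ (m - 1))
      | (None, Some _) \<Rightarrow> 0
      | (None, None) \<Rightarrow> (if m = 0 then 1 else 0)))"
proof (induction m)
  case 0
  show ?case by (auto simp: mat_def vec_eq_iff split: option.splits)
next
  case (Suc m)
  show ?case
    unfolding funpow.simps o_apply Suc.IH
    by (cases m) (auto simp: matrix_matrix_mult_def alg_mat_def vec_eq_iff
          sum_UNIV_option[where 'a = "'a option"] if_distrib[of "\<lambda>x. x * _"] sum.delta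
          cong: if_cong split: option.splits)
qed

lemma sums_vecI:
  fixes f :: "nat \<Rightarrow> 'b::real_normed_vector^'k"
  assumes "\<And>i. (\<lambda>n. f n $ i) sums (s $ i)"
  shows "f sums s"
  using assms unfolding sums_def by (intro vec_tendstoI) simp

text \<open>
  The exponential series is summed entry by entry: the diagonal gives exponential series, and the
  last column of the \<open>m\<close>-th power has the shifted entries \<open>a_k b_k^(m - 1)\<close>, which give
  \<open>exp_ratio\<close>.
\<close>

lemma matrix_exp_alg_mat: "matrix_exp (alg_mat u) = G_param (exp_coords u)"
  unfolding matrix_exp_def
proof (rule sums_unique[symmetric], intro sums_vecI)
  fix i j :: "'a option option"
  have diag: "(\<lambda>m. w ^ m / fact m) sums exp w" for w :: real by (rule exp_sums)
  have col: "(\<lambda>m. if m = 0 then 0 else a * w ^ (m - 1) / fact m) sums (a * exp_ratio w)"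
    for a w :: real
    using sums_mult[OF exp_ratio_sums, of a w] by (simp add: if_distrib cong: if_cong)
  have one: "(\<lambda>m::nat. if m = 0 then 1 else 0) sums (1::real)"
    using sums_single[of 0 "\<lambda>_. 1::real"] by simp
  show "(\<lambda>m. ((1 / fact m) *\<^sub>R ((**) (alg_mat u) ^^ m) (mat 1)) $ i $ j)
      sums (G_param (exp_coords u) $ i $ j)"
    using diag col one
    by (cases i; cases j)
       (auto simp: alg_mat_power G_param_def exp_coords_def if_distrib[of "\<lambda>x. x / _"] cong: if_cong)
qed

section \<open>Homogeneous vectors\<close>

definition equimodular :: "real^'k \<Rightarrow> bool" where
  "equimodular a \<longleftrightarrow> (\<exists>s. \<forall>i. \<bar>a $ i\<bar> = s)"

definition homogeneous_vector :: "'n::finite coords \<Rightarrow> bool" where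
  "homogeneous_vector u \<longleftrightarrow> u \<noteq> 0 \<and> (fst u = 0 \<or> snd u = 0 \<and> equimodular (fst u))"

definition one_param :: "'n::finite coords \<Rightarrow> real \<Rightarrow> 'n coords" where
  "one_param u t = exp_coords (t *\<^sub>R u)"

lemma one_param_eq:
  "one_param u t =
    ((\<chi> i. if full_z (snd u) i = 0 then t * fst u $ i
          else fst u $ i * (exp (t * full_z (snd u) i) - 1) / full_z (snd u) i),
     t *\<^sub>R snd u)"
  by (auto simp: one_param_def exp_coords_def exp_ratio_def vec_eq_iff)

lemma matrix_exp_scaleR_alg_mat:
  "matrix_exp (t *\<^sub>R alg_mat u) = G_param (one_param u t)"
  by (simp add: one_param_def matrix_exp_alg_mat flip: linear_scale[OF linear_alg_mat])

text \<open>
  Already the point at time 1 determines the vector, since \<open>exp_ratio\<close> has no zeros. Hence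
  counting curves amounts to counting vectors.
\<close>

lemma inj_one_param: "inj one_param"
proof (rule injI)
  fix u v :: "'a coords"
  assume "one_param u = one_param v"
  then have eq: "exp_coords u = exp_coords v"
    by (metis one_param_def scaleR_one)
  then have "snd u = snd v"
    by (simp add: exp_coords_def)
  with eq show "u = v"
    by (simp add: exp_coords_def vec_eq_iff exp_ratio_nonzero prod_eq_iff)
qed

lemma has_vector_derivative_vecI:
  fixes f :: "real \<Rightarrow> real^'k"
  assumes "\<And>i. ((\<lambda>t. f t $ i) has_real_derivative f' $ i) (at t)"
  shows "(f has_vector_derivative f') (at t)"
  unfolding has_vector_derivative_def
  using assms by (intro has_derivative_vecI) (simp add: has_field_derivative_def mult_commute_abs)

lemma one_param_derivative:
  "(one_param u has_vector_derivative
     ((\<chi> i. fst u $ i * exp (t * full_z (snd u) i)), snd u)) (at t)"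
proof -
  have "((\<lambda>t. if w = 0 then t * a else a * (exp (t * w) - 1) / w) has_real_derivative
      a * exp (t * w)) (at t)" for a w :: real
    by (cases "w = 0") (auto intro!: derivative_eq_intros)
  moreover have "((\<lambda>t. t *\<^sub>R b) has_vector_derivative b) (at t)" for b :: "real^'a"
    by (auto intro!: derivative_eq_intros)
  ultimately show ?thesis
    unfolding one_param_eq
    by (intro has_vector_derivative_Pair, intro has_vector_derivative_vecI) (simp_all only: vec_lambda_beta)
qed

lemma one_param_derivative2:
  "((\<lambda>t. ((\<chi> i. fst u $ i * exp (t * full_z (snd u) i)), snd u)) has_vector_derivative
     ((\<chi> i. fst u $ i * full_z (snd u) i * exp (t * full_z (snd u) i)), 0)) (at t)"
  by (rule has_vector_derivative_Pair has_vector_derivative_vecI)+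
     (auto intro!: derivative_eq_intros)

text \<open>
  Velocity and acceleration of the curve are known, so the geodesic equation becomes an
  identity between two linear forms in the test vector \<open>y\<close>; the factors \<open>exp (\<plusminus> t b_i)\<close> from the
  velocity and the metric mostly cancel.
\<close>

lemma chart_geodesic_one_param_iff:
  fixes u :: "'n::{finite,linorder} coords"
  assumes "lam \<noteq> 0"
  shows "chart_geodesic (coord_metric lam) (one_param u) \<longleftrightarrow>
    (\<forall>t y. (\<Sum>i\<in>UNIV. full_z (snd u) i * exp (- t * full_z (snd u) i) * (fst u $ i) * (fst y $ i))
          = (\<Sum>i\<in>UNIV. full_z (snd y) i * (fst u $ i)\<^sup>2))"
proof -
  let ?c' = "\<lambda>t. ((\<chi> i. fst u $ i * exp (t * full_z (snd u) i)), snd u)"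
  let ?c'' = "\<lambda>t. ((\<chi> i. fst u $ i * full_z (snd u) i * exp (t * full_z (snd u) i)), 0) :: 'n coords"
  have "chart_geodesic (coord_metric lam) (one_param u) \<longleftrightarrow>
      (\<forall>t. ?c'' t + christoffel (coord_metric lam) (one_param u t) (?c' t) (?c' t) = 0)"
  proof
    assume "chart_geodesic (coord_metric lam) (one_param u)"
    then obtain c' c'' where c: "\<And>t. (one_param u has_vector_derivative c' t) (at t)"
        "\<And>t. (c' has_vector_derivative c'' t) (at t)"
        "\<And>t. c'' t + christoffel (coord_metric lam) (one_param u t) (c' t) (c' t) = 0"
      unfolding chart_geodesic_def by blast
    have c': "c' = ?c'"
      using vector_derivative_unique_at[OF c(1) one_param_derivative] by blast
    have "c'' = ?c''"
      using vector_derivative_unique_at[OF c(2)[unfolded c'] one_param_derivative2] by blast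
    with c(3) c' show "\<forall>t. ?c'' t + christoffel (coord_metric lam) (one_param u t) (?c' t) (?c' t) = 0"
      by simp
  next
    assume "\<forall>t. ?c'' t + christoffel (coord_metric lam) (one_param u t) (?c' t) (?c' t) = 0"
    then show "chart_geodesic (coord_metric lam) (one_param u)"
      unfolding chart_geodesic_def
      by (intro exI[of _ ?c'] exI[of _ ?c''] allI conjI one_param_derivative one_param_derivative2) simp
  qed
  also have "\<dots> \<longleftrightarrow>
      (\<forall>t y. (\<Sum>i\<in>UNIV. full_z (snd u) i * exp (- t * full_z (snd u) i) * (fst u $ i) * (fst y $ i))
          = (\<Sum>i\<in>UNIV. full_z (snd y) i * (fst u $ i)\<^sup>2))"
  proof (intro iff_allI)
    fix t
    let ?E = "\<lambda>i. exp (t * full_z (snd u) i)" and ?F = "\<lambda>i. exp (- t * full_z (snd u) i)"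
    have p: "full_z (snd (one_param u t)) i = t * full_z (snd u) i" for i
      by (simp add: one_param_eq)
    have EF: "exp (- 2 * (t * full_z (snd u) i)) = ?F i * ?F i" "?E i * ?F i = 1" for i
      by (simp_all flip: exp_add)
    have 1: "(\<Sum>i\<in>UNIV. full_z (snd y) i * exp (- 2 * full_z (snd (one_param u t)) i)
              * (fst (?c' t) $ i)\<^sup>2)
        = (\<Sum>i\<in>UNIV. full_z (snd y) i * (fst u $ i)\<^sup>2)" for y :: "'n coords"
    proof (rule sum.cong[OF refl])
      fix i
      have "full_z (snd y) i * exp (- 2 * full_z (snd (one_param u t)) i) * (fst (?c' t) $ i)\<^sup>2
          = full_z (snd y) i * (fst u $ i)\<^sup>2 * (?E i * ?F i)\<^sup>2"
        unfolding p EF(1) by (simp add: power2_eq_square)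
      then show "full_z (snd y) i * exp (- 2 * full_z (snd (one_param u t)) i) * (fst (?c' t) $ i)\<^sup>2
          = full_z (snd y) i * (fst u $ i)\<^sup>2"
        unfolding EF(2) by simp
    qed
    have 2: "(\<Sum>i\<in>UNIV. full_z (snd u) i * exp (- 2 * full_z (snd (one_param u t)) i)
              * (fst (?c' t) $ i) * (fst y $ i))
        = (\<Sum>i\<in>UNIV. full_z (snd u) i * ?F i * (fst u $ i) * (fst y $ i))" for y :: "'n coords"
    proof (rule sum.cong[OF refl])
      fix i
      have "full_z (snd u) i * exp (- 2 * full_z (snd (one_param u t)) i)
              * (fst (?c' t) $ i) * (fst y $ i)
          = full_z (snd u) i * ?F i * (fst u $ i) * (fst y $ i) * (?E i * ?F i)"
        unfolding p EF(1) by simp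
      then show "full_z (snd u) i * exp (- 2 * full_z (snd (one_param u t)) i)
              * (fst (?c' t) $ i) * (fst y $ i)
          = full_z (snd u) i * ?F i * (fst u $ i) * (fst y $ i)"
        unfolding EF(2) by simp
    qed
    have 3: "coord_metric lam (one_param u t) (?c'' t) y
        = (\<Sum>i\<in>UNIV. full_z (snd u) i * ?F i * (fst u $ i) * (fst y $ i))" for y :: "'n coords"
      unfolding 2[symmetric] coord_metric_eq by (simp add: algebra_simps)
    have "?c'' t + christoffel (coord_metric lam) (one_param u t) (?c' t) (?c' t) = 0 \<longleftrightarrow>
        christoffel (coord_metric lam) (one_param u t) (?c' t) (?c' t) = - ?c'' t"
      by (subst eq_neg_iff_add_eq_0) (simp only: add.commute)
    also have "\<dots> \<longleftrightarrow> (\<forall>y.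
          (\<Sum>i\<in>UNIV. full_z (snd u) i * ?F i * (fst u $ i) * (fst y $ i))
          = (\<Sum>i\<in>UNIV. full_z (snd y) i * (fst u $ i)\<^sup>2))"
      unfolding christoffel_coord_metric_iff[OF assms] coord_metric_linear 3 1 snd_conv 2
      by (intro iff_allI) linarith
    finally show "?c'' t + christoffel (coord_metric lam) (one_param u t) (?c' t) (?c' t) = 0 \<longleftrightarrow>
        (\<forall>y. (\<Sum>i\<in>UNIV. full_z (snd u) i * ?F i * (fst u $ i) * (fst y $ i))
          = (\<Sum>i\<in>UNIV. full_z (snd y) i * (fst u $ i)\<^sup>2))" .
  qed
  finally show ?thesis .
qed

lemma sum_full_z_axis:
  "(\<Sum>i\<in>UNIV. full_z (axis j 1) i * f i) = f (Some j) - f None"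
  by (simp add: sum_UNIV_option axis_def if_distrib[of "\<lambda>x. x * _"] cong: if_cong)

text \<open>
  Necessity needs only the identity at time 0: testing with the \<open>z\<close>-axes compares \<open>a_j\<^sup>2\<close> with
  \<open>a_0\<^sup>2\<close>, and testing with the \<open>x\<close>-axes gives \<open>a_k b_k = 0\<close>. If \<open>a \<noteq> 0\<close>, all its entries are
  nonzero, whence \<open>b = 0\<close>. Conversely both sides vanish at all times, the right-hand side because
  the entries of \<open>full_z\<close> add up to zero.
\<close>

lemma geodesic_vector_iff:
  fixes u :: "'n::{finite,linorder} coords"
  assumes "lam \<noteq> 0" and "u \<noteq> 0"
  shows "chart_geodesic (coord_metric lam) (one_param u) \<longleftrightarrow> homogeneous_vector u"
  unfolding chart_geodesic_one_param_iff[OF assms(1)]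
proof
  assume R [rule_format]:
    "\<forall>t y. (\<Sum>i\<in>UNIV. full_z (snd u) i * exp (- t * full_z (snd u) i) * (fst u $ i) * (fst y $ i))
          = (\<Sum>i\<in>UNIV. full_z (snd y) i * (fst u $ i)\<^sup>2)"
  have "(fst u $ Some j)\<^sup>2 = (fst u $ None)\<^sup>2" for j
    using R[of 0 "(0, axis j 1)"] by (simp add: sum_full_z_axis)
  then have "\<bar>fst u $ Some j\<bar> = \<bar>fst u $ None\<bar>" for j
    by (simp add: power2_eq_iff abs_eq_iff)
  then have s: "\<bar>fst u $ i\<bar> = \<bar>fst u $ None\<bar>" for i
    by (cases i) auto
  have z: "full_z (snd u) k * fst u $ k = 0" for k
    using R[of 0 "(axis k 1, 0)"] by (simp add: axis_def if_distrib cong: if_cong)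
  have "snd u = 0" if "fst u \<noteq> 0"
  proof (rule full_z_eq_0D)
    fix i
    have "fst u $ i \<noteq> 0"
      using that s by (metis abs_eq_0_iff vec_eq_iff zero_index)
    with z[of i] show "full_z (snd u) i = 0" by simp
  qed
  with s assms(2) show "homogeneous_vector u"
    unfolding homogeneous_vector_def equimodular_def by blast
next
  assume u: "homogeneous_vector u"
  then obtain s where s: "\<And>i. \<bar>fst u $ i\<bar> = s" and z: "\<And>i. full_z (snd u) i * fst u $ i = 0"
    unfolding homogeneous_vector_def equimodular_def
    by (metis abs_0 full_z_linear(1) mult_zero_left mult_zero_right zero_index)
  have sq: "(fst u $ i)\<^sup>2 = s\<^sup>2" for i
    by (metis s power2_abs)
  have l: "full_z (snd u) i * exp (- t * full_z (snd u) i) * (fst u $ i) * (fst y $ i) = 0"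
    for t i and y :: "'n coords"
    using z[of i] by auto
  show "\<forall>t y. (\<Sum>i\<in>UNIV. full_z (snd u) i * exp (- t * full_z (snd u) i) * (fst u $ i) * (fst y $ i))
          = (\<Sum>i\<in>UNIV. full_z (snd y) i * (fst u $ i)\<^sup>2)"
    by (simp only: l sq sum.neutral_const flip: sum_distrib_right) simp
qed

lemma homogeneous_geodesic_iff:
  assumes "lam \<noteq> 0"
  shows "homogeneous_geodesic lam X \<gamma> \<longleftrightarrow>
    (\<exists>u. homogeneous_vector u \<and> X = alg_mat u \<and> \<gamma> = G_param \<circ> one_param u)"
proof -
  have curve: "(\<lambda>t. matrix_exp (t *\<^sub>R alg_mat u)) = G_param \<circ> one_param u" for u :: "'a coords"
    by (simp add: fun_eq_iff matrix_exp_scaleR_alg_mat)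
  have geo: "G_geodesic lam (G_param \<circ> one_param u) \<longleftrightarrow> chart_geodesic (coord_metric lam) (one_param u)"
    for u :: "'a coords"
    by (auto simp: G_geodesic_def G_group_def o_def)
  have nz: "alg_mat u = 0 \<longleftrightarrow> u = 0" for u :: "'a coords"
    using linear_injective_0[OF linear_alg_mat] inj_alg_mat linear_0[OF linear_alg_mat] by metis
  have hom: "homogeneous_vector u \<longleftrightarrow> u \<noteq> 0 \<and> chart_geodesic (coord_metric lam) (one_param u)"
    for u :: "'a coords"
    using geodesic_vector_iff[OF assms] unfolding homogeneous_vector_def by blast
  show ?thesis
  proof
    assume L: "homogeneous_geodesic lam X \<gamma>"
    then obtain u where X: "X = alg_mat u"
      unfolding homogeneous_geodesic_def tangent_space_def G_diff_mat_1 by blast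
    show "\<exists>u. homogeneous_vector u \<and> X = alg_mat u \<and> \<gamma> = G_param \<circ> one_param u"
      using L unfolding X homogeneous_geodesic_def hom
      by (intro exI[of _ u]) (metis curve geo nz)
  next
    assume "\<exists>u. homogeneous_vector u \<and> X = alg_mat u \<and> \<gamma> = G_param \<circ> one_param u"
    then show "homogeneous_geodesic lam X \<gamma>"
      unfolding homogeneous_geodesic_def tangent_space_def G_diff_mat_1 hom
      by (metis curve geo nz rangeI)
  qed
qed

section \<open>Families of homogeneous vectors\<close>

lemma inj_geodesic: "inj (\<lambda>u. G_param \<circ> one_param u)"
  using inj_one_param inj_G_param by (metis (no_types, lifting) fun.inj_map_strong inj_def)

lemma coord_metric_0:
  "coord_metric lam 0 u v = fst u \<bullet> fst v
    + lam\<^sup>2 / 2 * ((\<chi> i. full_z (snd u) i) \<bullet> (\<chi> i. full_z (snd v) i))"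
  by (simp add: coord_metric_eq inner_vec_def)

definition orthogonal_homogeneous_vectors ::
  "real \<Rightarrow> 'n::{finite,linorder} coords set \<Rightarrow> bool" where
  "orthogonal_homogeneous_vectors lam S \<longleftrightarrow> finite S \<and> (\<forall>u\<in>S. homogeneous_vector u) \<and>
     pairwise (\<lambda>u v. coord_metric lam 0 u v = 0) S"

lemma orthogonal_homogeneous_geodesics_iff:
  assumes "lam \<noteq> 0"
  shows "orthogonal_homogeneous_geodesics lam \<Gamma> \<longleftrightarrow>
    (\<exists>S. orthogonal_homogeneous_vectors lam S \<and> \<Gamma> = (\<lambda>u. G_param \<circ> one_param u) ` S)"
    (is "_ \<longleftrightarrow> (\<exists>S. _ \<and> \<Gamma> = ?c ` S)")
proof
  assume "orthogonal_homogeneous_geodesics lam \<Gamma>"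
  then obtain X where fin: "finite \<Gamma>" and X: "\<And>\<gamma>. \<gamma> \<in> \<Gamma> \<Longrightarrow> homogeneous_geodesic lam (X \<gamma>) \<gamma>"
    and orth: "pairwise (\<lambda>\<gamma> \<delta>. G_metric lam (mat 1) (X \<gamma>) (X \<delta>) = 0) \<Gamma>"
    unfolding orthogonal_homogeneous_geodesics_def by blast
  from X have "\<forall>\<gamma>\<in>\<Gamma>. \<exists>u. homogeneous_vector u \<and> X \<gamma> = alg_mat u \<and> \<gamma> = ?c u"
    using homogeneous_geodesic_iff[OF assms] by blast
  then obtain U where U: "\<forall>\<gamma>\<in>\<Gamma>. homogeneous_vector (U \<gamma>) \<and> X \<gamma> = alg_mat (U \<gamma>) \<and> \<gamma> = ?c (U \<gamma>)"
    by metis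
  have "pairwise (\<lambda>u v. coord_metric lam 0 u v = 0) (U ` \<Gamma>)"
    using orth U by (force simp: pairwise_def G_metric_mat_1)
  then have "orthogonal_homogeneous_vectors lam (U ` \<Gamma>)"
    using fin U by (auto simp: orthogonal_homogeneous_vectors_def)
  moreover have "\<Gamma> = ?c ` U ` \<Gamma>"
    using U by (simp add: image_image)
  ultimately show "\<exists>S. orthogonal_homogeneous_vectors lam S \<and> \<Gamma> = ?c ` S"
    by blast
next
  assume "\<exists>S. orthogonal_homogeneous_vectors lam S \<and> \<Gamma> = ?c ` S"
  then obtain S where S: "orthogonal_homogeneous_vectors lam S" and \<Gamma>: "\<Gamma> = ?c ` S"
    by blast
  let ?X = "\<lambda>\<gamma>. alg_mat (inv ?c \<gamma>)"
  have inv: "inv ?c (?c u) = u" for u :: "'a coords"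
    by (rule inv_f_f[OF inj_geodesic])
  have "\<forall>\<gamma>\<in>\<Gamma>. homogeneous_geodesic lam (?X \<gamma>) \<gamma>"
    using S unfolding \<Gamma> orthogonal_homogeneous_vectors_def homogeneous_geodesic_iff[OF assms]
    by (metis (no_types, lifting) imageE inv)
  moreover have "pairwise (\<lambda>\<gamma> \<delta>. G_metric lam (mat 1) (?X \<gamma>) (?X \<delta>) = 0) \<Gamma>"
    using S unfolding \<Gamma> orthogonal_homogeneous_vectors_def pairwise_image
    by (auto simp: inv G_metric_mat_1 pairwise_def simp del: split_paired_All)
  moreover have "finite \<Gamma>"
    using S by (simp add: \<Gamma> orthogonal_homogeneous_vectors_def)
  ultimately show "orthogonal_homogeneous_geodesics lam \<Gamma>"
    unfolding orthogonal_homogeneous_geodesics_def by (intro conjI exI[of _ ?X])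
qed

lemma max_card_image_iff:
  assumes "inj f" and "\<And>T. P T \<longleftrightarrow> (\<exists>S. Q S \<and> T = f ` S)"
  shows "max_card P m \<longleftrightarrow> max_card Q m"
  using assms(2) card_image[OF inj_on_subset[OF assms(1) subset_UNIV]]
  unfolding max_card_def by metis

lemma finite_orthogonal_nonzero_card:
  fixes S :: "'a::euclidean_space set"
  assumes "pairwise orthogonal S" and "0 \<notin> S"
  shows "finite S" and "card S \<le> DIM('a)"
  using pairwise_orthogonal_independent[OF assms] independent_bound by blast+

text \<open>
  These are, up to scaling, the orthogonal families of sign vectors. Scaling is left free because
  the \<open>x\<close>-components of homogeneous vectors are not normalised.
\<close>

definition orthogonal_equimodular :: "(real^'k) set \<Rightarrow> bool" where
  "orthogonal_equimodular E \<longleftrightarrow>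
     pairwise orthogonal E \<and> (\<forall>a\<in>E. a \<noteq> 0 \<and> equimodular a)"

text \<open>
  Split the family by kind. The \<open>z\<close>-parts of the first kind lie in the hyperplane orthogonal to
  the all-ones vector, so there are at most \<open>n\<close> of them; the \<open>x\<close>-parts of the second kind form
  the required family \<open>E\<close>.
\<close>

lemma orthogonal_homogeneous_vectors_card_le:
  fixes S :: "'n::{finite,linorder} coords set"
  assumes "lam \<noteq> 0" and "orthogonal_homogeneous_vectors lam S"
  obtains E :: "(real^'n option) set"
  where "orthogonal_equimodular E" and "card S \<le> CARD('n) + card E"
proof -
  let ?Z = "\<lambda>u::'n coords. (\<chi> i. full_z (snd u) i)"
  define V where "V = {u \<in> S. fst u = 0}"
  define W where "W = {u \<in> S. snd u = 0}"
  have fin: "finite S" and hom: "\<And>u. u \<in> S \<Longrightarrow> homogeneous_vector u"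
    and orth: "\<And>u v. u \<in> S \<Longrightarrow> v \<in> S \<Longrightarrow> u \<noteq> v \<Longrightarrow> coord_metric lam 0 u v = 0"
    using assms(2) by (auto simp: orthogonal_homogeneous_vectors_def pairwise_def)
  have S: "S = V \<union> W"
    using hom by (auto simp: V_def W_def homogeneous_vector_def)

  have injZ: "inj_on ?Z V"
    by (rule inj_onI) (auto simp: V_def prod_eq_iff vec_eq_iff dest: spec[of _ "Some _"])
  have Zorth: "orthogonal (?Z u) (?Z v)" if "u \<in> V" "v \<in> V" "u \<noteq> v" for u v
    using orth[of u v] that assms(1) by (auto simp: V_def coord_metric_0 orthogonal_def)
  have Z1: "orthogonal 1 (?Z u)" "orthogonal (?Z u) 1" for u
    by (simp_all add: orthogonal_def inner_vec_def)
  have Z0: "?Z u \<noteq> 0" if "u \<in> V" for u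
    using hom[of u] that full_z_eq_0D[of "snd u"]
    by (auto simp: V_def homogeneous_vector_def vec_eq_iff prod_eq_iff)
  have one: "1 \<notin> ?Z ` V"
  proof
    assume "1 \<in> ?Z ` V"
    then obtain u where "1 = ?Z u" by blast
    with Z1(1)[of u] have "orthogonal 1 (1 :: real^'n option)" by (simp only:)
    then show False by (simp add: orthogonal_self)
  qed
  \<comment> \<open>Adjoining the all-ones vector gives an orthogonal family in dimension \<open>n + 1\<close>, which
      saves one over the bound for the \<open>z\<close>-parts alone.\<close>
  have "pairwise orthogonal (?Z ` V)"
    unfolding pairwise_image using Zorth by (intro pairwiseI) blast
  then have "pairwise orthogonal (insert 1 (?Z ` V))"
    unfolding pairwise_insert using Z1 by blast
  then have "card (insert 1 (?Z ` V)) \<le> DIM(real^'n option)"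
    using Z0 by (intro finite_orthogonal_nonzero_card) auto
  then have V: "card V \<le> CARD('n)"
    using fin one card_image[OF injZ] finite_subset[of V S] by (simp add: V_def)

  have "inj_on fst W"
    by (rule inj_onI) (auto simp: W_def prod_eq_iff)
  then have W: "card W = card (fst ` W)"
    by (simp add: card_image)
  have Worth: "fst u \<bullet> fst v = 0" if "u \<in> W" "v \<in> W" "u \<noteq> v" for u v
    using orth[of u v] that by (simp add: W_def coord_metric_0 inner_vec_def)
  have "pairwise orthogonal (fst ` W)"
    unfolding pairwise_image orthogonal_def using Worth by (intro pairwiseI) blast
  moreover have "fst u \<noteq> 0 \<and> equimodular (fst u)" if "u \<in> W" for u
    using hom[of u] that by (auto simp: W_def homogeneous_vector_def prod_eq_iff)
  ultimately have "orthogonal_equimodular (fst ` W)"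
    by (simp add: orthogonal_equimodular_def)
  moreover have "card S \<le> CARD('n) + card (fst ` W)"
    unfolding S using card_Un_le[of V W] V W by linarith
  ultimately show thesis by (rule that)
qed

text \<open>
  The \<open>z\<close>-metric at the identity is a multiple of the Euclidean one on the sum-zero hyperplane, so
  an orthonormal basis of that hyperplane supplies \<open>n\<close> vectors of the first kind, orthogonal to
  everything of the second kind.
\<close>

lemma orthogonal_homogeneous_vectors_extend:
  fixes E :: "(real^'n::{finite,linorder} option) set"
  assumes "orthogonal_equimodular E"
  obtains S :: "'n coords set"
  where "orthogonal_homogeneous_vectors lam S" and "card S = CARD('n) + card E"
proof -
  let ?H = "{x. (1 :: real^'n option) \<bullet> x = 0}"
  obtain B where B: "B \<subseteq> ?H" "pairwise orthogonal B" "\<And>x. x \<in> B \<Longrightarrow> norm x = 1"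
      "card B = dim ?H" "finite B"
    using orthonormal_basis_subspace[OF subspace_hyperplane] independent_imp_finite by metis
  have cB: "card B = CARD('n)"
    by (simp add: B(4) dim_hyperplane)
  define r :: "real^'n option \<Rightarrow> 'n coords" where "r x = (0, \<chi> j. x $ Some j)" for x
  have full: "full_z (snd (r x)) i = x $ i" if "x \<in> B" for x i
    using that B(1) by (auto simp: r_def inner_vec_def intro!: full_z_restrict)
  have finE: "finite E"
    using assms finite_orthogonal_nonzero_card by (auto simp: orthogonal_equimodular_def)
  let ?e = "\<lambda>a. (a, 0) :: 'n coords"
  let ?S = "r ` B \<union> ?e ` E"
  have injr: "inj_on r B"
    by (rule inj_onI) (metis full vec_eq_iff)
  have rnz: "r x \<noteq> 0" if "x \<in> B" for x
  proof
    assume "r x = 0"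
    then have "x = 0" using full[OF that] by (simp add: vec_eq_iff)
    with B(3)[OF that] show False by simp
  qed
  have disj: "r ` B \<inter> ?e ` E = {}"
    using assms by (auto simp: r_def orthogonal_equimodular_def)
  have "card ?S = CARD('n) + card E"
    using B(5) finE disj cB
    by (simp add: card_Un_disjoint card_image[OF injr] card_image[of ?e] inj_on_def)
  moreover have "orthogonal_homogeneous_vectors lam ?S"
    unfolding orthogonal_homogeneous_vectors_def
  proof (intro conjI ballI pairwiseI)
    show "finite ?S" using B(5) finE by simp
    show "homogeneous_vector u" if "u \<in> ?S" for u
      using that rnz assms
      by (auto simp: homogeneous_vector_def orthogonal_equimodular_def r_def prod_eq_iff)
    show "coord_metric lam 0 u v = 0" if uv: "u \<in> ?S" "v \<in> ?S" "u \<noteq> v" for u v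
    proof -
      have fst_r: "fst (r x) = 0" for x by (simp add: r_def)
      have 1: "coord_metric lam 0 (r x) (r y) = 0" if "x \<in> B" "y \<in> B" "x \<noteq> y" for x y
        using that B(2) by (simp add: coord_metric_0 fst_r full pairwise_def orthogonal_def)
      have 2: "coord_metric lam 0 (r x) (?e a) = 0" "coord_metric lam 0 (?e a) (r x) = 0" for x a
        by (simp_all add: coord_metric_0 fst_r inner_vec_def)
      have 3: "coord_metric lam 0 (?e a) (?e b) = 0" if "a \<in> E" "b \<in> E" "a \<noteq> b" for a b
        using that assms
        by (auto simp: coord_metric_0 orthogonal_equimodular_def pairwise_def orthogonal_def inner_vec_def)
      from uv show ?thesis
        by (elim UnE imageE) (use 1 2 3 in \<open>blast+\<close>)
    qed
  qed
  ultimately show thesis using that by blast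
qed

lemma max_card_orthogonal_homogeneous_geodesics:
  assumes "lam \<noteq> 0"
    and "max_card (orthogonal_equimodular :: (real^'n::{finite,linorder} option) set \<Rightarrow> bool) m"
  shows "max_card (orthogonal_homogeneous_geodesics lam :: (real \<Rightarrow> 'n gmatrix) set \<Rightarrow> bool)
    (CARD('n) + m)"
proof -
  have "max_card (orthogonal_homogeneous_vectors lam :: 'n coords set \<Rightarrow> bool) (CARD('n) + m)"
    using assms(2) unfolding max_card_def
    by (metis (no_types, lifting) add_left_mono le_trans
        orthogonal_homogeneous_vectors_extend orthogonal_homogeneous_vectors_card_le[OF assms(1)])
  then show ?thesis
    by (subst max_card_image_iff[OF inj_geodesic])
       (auto simp: orthogonal_homogeneous_geodesics_iff[OF assms(1)])
qed

section \<open>Orthogonal vectors with entries of constant modulus\<close>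

text \<open>
  The counting device behind both divisibility results: a sum of terms \<open>0\<close> and \<open>c\<close> is a multiple
  of \<open>c\<close>.
\<close>

lemma sum_two_values:
  fixes f :: "'k::finite \<Rightarrow> real"
  assumes "\<And>i. f i = 0 \<or> f i = c"
  shows "\<exists>m. (\<Sum>i\<in>UNIV. f i) = c * real m"
proof -
  have "(\<Sum>i\<in>UNIV. f i) = (\<Sum>i\<in>UNIV. if i \<in> {i. f i = c} then c else 0)"
    using assms by (intro sum.cong) auto
  also have "\<dots> = c * real (card {i. f i = c})"
    by (simp add: sum.If_cases)
  finally show ?thesis by blast
qed

lemma equimodular_signs:
  assumes "equimodular a" and "a \<noteq> 0"
  obtains s and \<epsilon> :: "'k::finite \<Rightarrow> real"
  where "s > 0" and "\<And>i. a $ i = s * \<epsilon> i" and "\<And>i. \<epsilon> i = 1 \<or> \<epsilon> i = - 1"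
proof -
  obtain s where s: "\<And>i. \<bar>a $ i\<bar> = s"
    using assms(1) by (auto simp: equimodular_def)
  obtain i0 where "a $ i0 \<noteq> 0" using assms(2) by (auto simp: vec_eq_iff)
  then have "s > 0" using s[of i0] by auto
  moreover have "a $ i = s * (if a $ i = s then 1 else - 1)" for i
    using s[of i] by auto
  ultimately show thesis using that[of s "\<lambda>i. if a $ i = s then 1 else - 1"] by auto
qed

text \<open>
  For orthogonal sign vectors \<open>\<epsilon>\<close>, \<open>\<delta>\<close> the dimension is \<open>\<Sum> (1 + \<epsilon>_i \<delta>_i)\<close>, whose terms are 0 or 2.
\<close>

lemma orthogonal_equimodular_pair_even:
  fixes E :: "(real^'k) set"
  assumes "orthogonal_equimodular E" and "a \<in> E" "b \<in> E" "a \<noteq> b"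
  shows "even CARD('k)"
proof -
  have nz: "equimodular a" "a \<noteq> 0" "equimodular b" "b \<noteq> 0" and ab: "a \<bullet> b = 0"
    using assms by (auto simp: orthogonal_equimodular_def pairwise_def orthogonal_def)
  obtain s \<epsilon> where s: "s > 0" "\<And>i. a $ i = s * \<epsilon> i" "\<And>i. \<epsilon> i = 1 \<or> \<epsilon> i = (- 1::real)"
    using equimodular_signs[OF nz(1,2)] by metis
  obtain t \<delta> where t: "t > 0" "\<And>i. b $ i = t * \<delta> i" "\<And>i. \<delta> i = 1 \<or> \<delta> i = (- 1::real)"
    using equimodular_signs[OF nz(3,4)] by metis
  have "a \<bullet> b = (s * t) * (\<Sum>i\<in>UNIV. \<epsilon> i * \<delta> i)"
    by (simp add: inner_vec_def s(2) t(2) sum_distrib_left mult_ac)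
  with ab s(1) t(1) have 0: "(\<Sum>i\<in>UNIV. \<epsilon> i * \<delta> i) = 0" by simp
  have "(1 + \<epsilon> i * \<delta> i) = 0 \<or> (1 + \<epsilon> i * \<delta> i) = 2" for i
    using s(3)[of i] t(3)[of i] by auto
  from sum_two_values[of "\<lambda>i. 1 + \<epsilon> i * \<delta> i", OF this]
  obtain m where "(\<Sum>i\<in>UNIV. 1 + \<epsilon> i * \<delta> i) = 2 * real m" by blast
  then have "real CARD('k) = real (2 * m)" by (simp add: sum.distrib 0)
  then have "CARD('k) = 2 * m" by (simp only: of_nat_eq_iff)
  then show ?thesis by simp
qed

text \<open>
  For orthogonal sign vectors \<open>\<epsilon>\<close>, \<open>\<delta>\<close>, \<open>\<eta>\<close> the dimension is \<open>\<Sum> (\<epsilon>_i + \<delta>_i) (\<epsilon>_i + \<eta>_i)\<close>, since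
  only \<open>\<Sum> \<epsilon>_i\<^sup>2\<close> survives after expanding. Each term is 0 or 4.
\<close>

lemma orthogonal_equimodular_triple_dvd4:
  fixes E :: "(real^'k) set"
  assumes "orthogonal_equimodular E" and "a \<in> E" "b \<in> E" "c \<in> E" "a \<noteq> b" "a \<noteq> c" "b \<noteq> c"
  shows "4 dvd CARD('k)"
proof -
  have nz: "equimodular a" "a \<noteq> 0" "equimodular b" "b \<noteq> 0" "equimodular c" "c \<noteq> 0"
    and ip: "a \<bullet> b = 0" "a \<bullet> c = 0" "b \<bullet> c = 0"
    using assms by (auto simp: orthogonal_equimodular_def pairwise_def orthogonal_def)
  obtain s \<epsilon> where s: "s > 0" "\<And>i. a $ i = s * \<epsilon> i" "\<And>i. \<epsilon> i = 1 \<or> \<epsilon> i = (- 1::real)"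
    using equimodular_signs[OF nz(1,2)] by metis
  obtain t \<delta> where t: "t > 0" "\<And>i. b $ i = t * \<delta> i" "\<And>i. \<delta> i = 1 \<or> \<delta> i = (- 1::real)"
    using equimodular_signs[OF nz(3,4)] by metis
  obtain r \<eta> where r: "r > 0" "\<And>i. c $ i = r * \<eta> i" "\<And>i. \<eta> i = 1 \<or> \<eta> i = (- 1::real)"
    using equimodular_signs[OF nz(5,6)] by metis
  have "a \<bullet> b = (s * t) * (\<Sum>i\<in>UNIV. \<epsilon> i * \<delta> i)"
    and "a \<bullet> c = (s * r) * (\<Sum>i\<in>UNIV. \<epsilon> i * \<eta> i)"
    and "b \<bullet> c = (t * r) * (\<Sum>i\<in>UNIV. \<delta> i * \<eta> i)"
    by (simp_all add: inner_vec_def s(2) t(2) r(2) sum_distrib_left mult_ac)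
  with ip s(1) t(1) r(1)
  have 0: "(\<Sum>i\<in>UNIV. \<epsilon> i * \<delta> i) = 0" "(\<Sum>i\<in>UNIV. \<epsilon> i * \<eta> i) = 0" "(\<Sum>i\<in>UNIV. \<delta> i * \<eta> i) = 0"
    by simp_all
  have "(\<epsilon> i + \<delta> i) * (\<epsilon> i + \<eta> i) = 0 \<or> (\<epsilon> i + \<delta> i) * (\<epsilon> i + \<eta> i) = 4" for i
    using s(3)[of i] t(3)[of i] r(3)[of i] by auto
  from sum_two_values[of "\<lambda>i. (\<epsilon> i + \<delta> i) * (\<epsilon> i + \<eta> i)", OF this]
  obtain m where m: "(\<Sum>i\<in>UNIV. (\<epsilon> i + \<delta> i) * (\<epsilon> i + \<eta> i)) = 4 * real m" by blast
  have sq: "\<epsilon> i * \<epsilon> i = 1" for i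
    using s(3)[of i] by auto
  have "(\<Sum>i\<in>UNIV. (\<epsilon> i + \<delta> i) * (\<epsilon> i + \<eta> i)) = real CARD('k)"
    using 0 by (simp add: distrib_left distrib_right sum.distrib sq mult.commute)
  with m have "real CARD('k) = real (4 * m)" by simp
  then have "CARD('k) = 4 * m" by (simp only: of_nat_eq_iff)
  then show ?thesis by simp
qed

lemma max_card_orthogonal_equimodular_odd:
  assumes "odd CARD('k)"
  shows "max_card (orthogonal_equimodular :: (real^'k) set \<Rightarrow> bool) 1"
  unfolding max_card_def
proof (intro conjI exI[of _ "{1}"] allI impI)
  show "orthogonal_equimodular {1 :: real^'k}"
    by (auto simp: orthogonal_equimodular_def equimodular_def)
  fix E :: "(real^'k) set" assume E: "orthogonal_equimodular E"
  then have "finite E"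
    using finite_orthogonal_nonzero_card by (auto simp: orthogonal_equimodular_def)
  moreover have "\<forall>a\<in>E. \<forall>b\<in>E. a = b"
    using orthogonal_equimodular_pair_even[OF E] assms by blast
  ultimately show "card E \<le> 1"
    by (simp add: card_le_Suc0_iff_eq)
qed simp

text \<open>
  In even dimension the all-ones vector is orthogonal to a sign vector with equally many entries
  of each sign.
\<close>

lemma max_card_orthogonal_equimodular_even:
  assumes "even CARD('k)" and "\<not> 4 dvd CARD('k)"
  shows "max_card (orthogonal_equimodular :: (real^'k) set \<Rightarrow> bool) 2"
proof -
  obtain T :: "'k set" where T: "card T = CARD('k) div 2"
    using obtain_subset_with_card_n[of "CARD('k) div 2" "UNIV :: 'k set"] by auto
  define b :: "real^'k" where "b = (\<chi> i. if i \<in> T then 1 else - 1)"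
  have "1 \<bullet> b = (\<Sum>i\<in>UNIV. if i \<in> T then 1 else - 1)"
    by (simp add: inner_vec_def b_def)
  also have "\<dots> = real (card T) - real (card (- T))"
    by (simp add: sum.If_cases)
  also have "\<dots> = 0"
    using assms(1) T by (auto simp: Compl_eq_Diff_UNIV card_Diff_subset elim!: evenE)
  finally have 1: "1 \<bullet> b = 0" .
  have nz: "b \<noteq> 0"
    by (auto simp: b_def vec_eq_iff)
  have "b \<noteq> 1" using 1 nz by auto
  moreover have "orthogonal_equimodular {1, b}"
    using 1 nz
    by (auto simp: orthogonal_equimodular_def equimodular_def pairwise_insert orthogonal_def
        inner_commute b_def intro!: exI[of _ 1])
  moreover have "card E \<le> 2" if E: "orthogonal_equimodular E" for E :: "(real^'k) set"
  proof (rule ccontr)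
    assume "\<not> card E \<le> 2"
    then obtain F where "F \<subseteq> E" "card F = 3"
      using obtain_subset_with_card_n[of 3 E] by auto
    then show False
      using orthogonal_equimodular_triple_dvd4[OF E] assms(2) by (auto simp: card_3_iff)
  qed
  ultimately show ?thesis
    unfolding max_card_def by (intro conjI exI[of _ "{1, b}"]) auto
qed

lemma max_card_orthogonal_equimodular_hadamard:
  fixes A :: "real^'k^'k"
  assumes "hadamard_matrix A"
  shows "max_card (orthogonal_equimodular :: (real^'k) set \<Rightarrow> bool) CARD('k)"
proof -
  have sign: "A $ i $ j = 1 \<or> A $ i $ j = - 1" for i j
    using assms by (simp add: hadamard_matrix_def)
  have rows: "A $ i \<bullet> A $ j = (if i = j then real CARD('k) else 0)" for i j
  proof -
    have "A $ i \<bullet> A $ j = (A ** transpose A) $ i $ j"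
      by (simp add: matrix_matrix_mult_def transpose_def inner_vec_def)
    then show ?thesis
      using assms by (simp add: hadamard_matrix_def mat_def)
  qed
  have "inj (($) A)"
    using rows by (intro injI) (metis of_nat_eq_0_iff zero_less_card_finite less_irrefl)
  then have "card (range (($) A)) = CARD('k)"
    by (rule card_image)
  moreover have "orthogonal_equimodular (range (($) A))"
  proof -
    have "A $ i \<noteq> 0" for i
      using rows[of i i] by auto
    moreover have "equimodular (A $ i)" for i
      unfolding equimodular_def using sign[of i] by (intro exI[of _ 1]) (metis abs_1 abs_minus_cancel)
    moreover have "pairwise orthogonal (range (($) A))"
      by (auto simp: pairwise_image pairwise_def orthogonal_def rows)
    ultimately show ?thesis by (auto simp: orthogonal_equimodular_def)
  qed
  moreover have "card E \<le> CARD('k)" if "orthogonal_equimodular E" for E :: "(real^'k) set"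
    using that finite_orthogonal_nonzero_card(2)[of E] by (auto simp: orthogonal_equimodular_def)
  ultimately show ?thesis
    unfolding max_card_def by blast
qed

section \<open>Linearly independent homogeneous geodesics\<close>

text \<open>
  The all-ones vector and the same vector with one sign flipped differ by twice a coordinate axis.
\<close>

lemma span_homogeneous_vectors: "span (Collect homogeneous_vector :: 'n::finite coords set) = UNIV"
proof -
  let ?H = "Collect homogeneous_vector :: 'n coords set"
  have z: "(0, b) \<in> span ?H" for b
  proof (cases "b = 0")
    case True
    then show ?thesis by (simp add: span_zero flip: zero_prod_def)
  next
    case False
    then show ?thesis by (intro span_base) (simp add: homogeneous_vector_def prod_eq_iff)
  qed
  have sign: "(a, 0) \<in> span ?H" if "\<And>i. \<bar>a $ i\<bar> = s" for a s
  proof (cases "a = 0")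
    case True
    then show ?thesis by (simp add: span_zero flip: zero_prod_def)
  next
    case False
    then show ?thesis
      using that by (intro span_base) (auto simp: homogeneous_vector_def prod_eq_iff equimodular_def)
  qed
  have ax: "(axis k 1, 0) \<in> span ?H" for k
  proof -
    have "(1, 0) - (\<chi> i. if i = k then - 1 else 1, 0) \<in> span ?H"
      by (intro span_diff sign[where s = 1]) auto
    moreover have "(1, 0) - (\<chi> i. if i = k then - 1 else 1, 0) = ((2 *\<^sub>R axis k 1, 0) :: 'n coords)"
      by (simp add: vec_eq_iff axis_def)
    ultimately have "(2 *\<^sub>R axis k 1, 0) \<in> span ?H" by simp
    from span_scale[OF this, of "1/2"] show ?thesis by simp
  qed
  have "(a, b) \<in> span ?H" for a b
  proof -
    have "(\<Sum>k\<in>UNIV. (a $ k) *\<^sub>R (axis k 1, 0)) + (0, b) \<in> span ?H"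
      by (intro span_add span_sum span_scale ax z)
    moreover have "(\<Sum>k\<in>UNIV. (a $ k) *\<^sub>R (axis k 1, 0)) = ((a, 0) :: 'n coords)"
      by (auto simp: prod_eq_iff fst_sum snd_sum vec_eq_iff axis_def if_distrib cong: if_cong)
    ultimately show ?thesis by simp
  qed
  then show ?thesis by auto
qed

lemma independent_homogeneous_geodesics_exist:
  assumes "lam \<noteq> 0"
  obtains \<Gamma> :: "(real \<Rightarrow> 'n::{finite,linorder} gmatrix) set"
  where "independent_homogeneous_geodesics lam \<Gamma>" and "card \<Gamma> = 2 * CARD('n) + 1"
proof -
  let ?c = "\<lambda>u::'n coords. G_param \<circ> one_param u"
  obtain B :: "'n coords set" where B: "B \<subseteq> Collect homogeneous_vector" "independent B"
      "card B = dim (Collect homogeneous_vector :: 'n coords set)"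
    by (rule basis_exists)
  have "dim (Collect homogeneous_vector :: 'n coords set) = DIM('n coords)"
    using span_homogeneous_vectors dim_span dim_UNIV by metis
  then have card: "card B = 2 * CARD('n) + 1"
    using B(3) by simp
  let ?X = "\<lambda>\<gamma>. alg_mat (inv ?c \<gamma>)"
  have inv: "inv ?c (?c u) = u" for u
    by (rule inv_f_f[OF inj_geodesic])
  have "\<forall>\<gamma>\<in>?c ` B. homogeneous_geodesic lam (?X \<gamma>) \<gamma>"
    using B(1) unfolding homogeneous_geodesic_iff[OF assms]
    by (metis (no_types, lifting) imageE inv mem_Collect_eq subsetD)
  moreover have "independent (?X ` ?c ` B)"
    using linear_independent_injective_image[OF linear_alg_mat B(2)
        inj_on_subset[OF inj_alg_mat subset_UNIV]]
    by (simp add: image_image inv)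
  moreover have "finite (?c ` B)"
    using B(2) independent_imp_finite by blast
  ultimately have "independent_homogeneous_geodesics lam (?c ` B)"
    unfolding independent_homogeneous_geodesics_def by (intro conjI exI[of _ ?X])
  moreover have "card (?c ` B) = 2 * CARD('n) + 1"
    using card card_image[OF inj_on_subset[OF inj_geodesic subset_UNIV]] by metis
  ultimately show thesis by (rule that)
qed

theorem corollary2p10:
  fixes lam :: real and n :: nat
  assumes "n = CARD('n::{finite,linorder})" and "n \<ge> 1" and "lam \<noteq> 0"
  shows
    "(\<exists>\<Gamma> :: (real \<Rightarrow> 'n gmatrix) set.
        independent_homogeneous_geodesics lam \<Gamma> \<and> card \<Gamma> = 2 * n + 1)
     \<and> (odd (n + 1) \<longrightarrow>
        max_card (orthogonal_homogeneous_geodesics lam :: (real \<Rightarrow> 'n gmatrix) set \<Rightarrow> bool) (n + 1))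
     \<and> (even (n + 1) \<and> \<not> 4 dvd (n + 1) \<longrightarrow>
        max_card (orthogonal_homogeneous_geodesics lam :: (real \<Rightarrow> 'n gmatrix) set \<Rightarrow> bool) (n + 2))
     \<and> (even (n + 1) \<and> 4 dvd (n + 1) \<and>
          (\<exists>A :: real^('n option)^('n option). hadamard_matrix A) \<longrightarrow>
        max_card (orthogonal_homogeneous_geodesics lam :: (real \<Rightarrow> 'n gmatrix) set \<Rightarrow> bool) (2 * n + 1))"
proof (intro conjI impI)
  have card: "CARD('n option) = n + 1"
    by (simp add: assms(1))
  note reduce = max_card_orthogonal_homogeneous_geodesics[OF assms(3), where 'n = 'n, folded assms(1)]
  show "\<exists>\<Gamma> :: (real \<Rightarrow> 'n gmatrix) set.
      independent_homogeneous_geodesics lam \<Gamma> \<and> card \<Gamma> = 2 * n + 1"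
    using independent_homogeneous_geodesics_exist[OF assms(3)] unfolding assms(1) by metis
  show "max_card (orthogonal_homogeneous_geodesics lam :: (real \<Rightarrow> 'n gmatrix) set \<Rightarrow> bool) (n + 1)"
    if "odd (n + 1)"
    using that by (intro reduce max_card_orthogonal_equimodular_odd) (simp only: card simp_thms)
  show "max_card (orthogonal_homogeneous_geodesics lam :: (real \<Rightarrow> 'n gmatrix) set \<Rightarrow> bool) (n + 2)"
    if "even (n + 1) \<and> \<not> 4 dvd (n + 1)"
    using that by (intro reduce max_card_orthogonal_equimodular_even) (simp_all only: card simp_thms)
  show "max_card (orthogonal_homogeneous_geodesics lam :: (real \<Rightarrow> 'n gmatrix) set \<Rightarrow> bool) (2 * n + 1)"
    if "even (n + 1) \<and> 4 dvd (n + 1) \<and> (\<exists>A :: real^('n option)^('n option). hadamard_matrix A)"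
  proof -
    from that obtain A :: "real^('n option)^('n option)" where "hadamard_matrix A" by blast
    from reduce[OF max_card_orthogonal_equimodular_hadamard[OF this]]
    show ?thesis unfolding card by (simp only: mult_2 add.assoc)
  qed
qed

end
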